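(* For any $s\in\mathbf{C}$ with $s\neq1$, $$\lim_{q\uparrow1}\zeta_q(s)=\zeta(s),$$ where $\zeta(s)$ is the Riemann zeta function analytically continued to $\mathbf{C}\setminus\{1\}$, and where, on the left-hand side, $q\in(0,1)$ avoids those values for which $\zeta_q$ has a pole at $s$ (there are no such values once $q$ is close enough to $1$).
   Context: For $0<q<1$ and an integer $n\ge1$ put $[n]_q=(1-q^n)/(1-q)>0$; powers of positive reals are $x^s=e^{s\log x}$ with real logarithm. For $\mathrm{Re}(s)>1$ define $$\zeta_q(s)=\sum_{n=1}^\infty\frac{q^{n(s-1)}}{[n]_q^s},$$ which converges absolutely there, and denote by the same symbol its meromorphic continuation to $s\in\mathbf{C}$, which is given by $$\zeta_q(s)=(1-q)^s\sum_{r=0}^\infty\binom{s+r-1}{r}\frac{q^{s+r-1}}{1-q^{s+r-1}},\qquad \binom{s+r-1}{r}=\frac{s(s+1)\cdots(s+r-1)}{r!}.$$ At a non-positive integer $s=-m$, the value $\zeta_q(-m)$ means $\lim_{s\to-m}\zeta_q(s)$, which exists and is finite. *)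

theory Defs
  imports "HOL-Complex_Analysis.Complex_Analysis"
begin

text \<open>
  The meromorphic continuation of \<open>f\<close> from \<open>A\<close> to the whole plane.
  A \<open>nicely_meromorphic_on\<close> function takes its limit as value at every point that is not a
  pole, and the value \<open>0\<close> at poles; in particular removable singularities are filled in by the
  limit, and the continuation is unique when \<open>A\<close> is open and nonempty.
\<close>

definition meromorphic_continuation ::
    "complex set \<Rightarrow> (complex \<Rightarrow> complex) \<Rightarrow> complex \<Rightarrow> complex" where
  "meromorphic_continuation A f =
     (THE g. g nicely_meromorphic_on UNIV \<and> (\<forall>s\<in>A. g s = f s))"

definition q_int :: "real \<Rightarrow> nat \<Rightarrow> real" where
  "q_int q n = (1 - q ^ n) / (1 - q)"

definition q_zeta_series :: "real \<Rightarrow> complex \<Rightarrow> complex" where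
  "q_zeta_series q s =
     (\<Sum>k. let n = Suc k in
        of_real q powr (of_nat n * (s - 1)) / of_real (q_int q n) powr s)"

definition q_zeta :: "real \<Rightarrow> complex \<Rightarrow> complex" where
  "q_zeta q = meromorphic_continuation {s. Re s > 1} (q_zeta_series q)"

text \<open>
  The Riemann zeta function; by the identity theorem its values on \<open>- {1}\<close> do not depend on
  the choice, and the value at \<open>1\<close> is unspecified.
\<close>

definition zeta :: "complex \<Rightarrow> complex" where
  "zeta = (SOME g. g holomorphic_on - {1} \<and>
     (\<forall>s. Re s > 1 \<longrightarrow> g s = (\<Sum>k. 1 / of_nat (Suc k) powr s)))"

lemma nicely_meromorphic_eqI:
  assumes f: "f nicely_meromorphic_on UNIV" and g: "g nicely_meromorphic_on UNIV"
    and A: "open A" "A \<noteq> {}" and eq: "\<And>s. s \<in> A \<Longrightarrow> f s = g s"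
  shows "f = g"
proof
  fix z
  define d where "d = (\<lambda>s. f s - g s)"
  have d: "d meromorphic_on UNIV"
    using f g unfolding d_def nicely_meromorphic_on_def by (auto intro: meromorphic_intros)
  have h: "remove_sings d nicely_meromorphic_on UNIV"
    by (rule remove_sings_nicely_meromorphic[OF d])
  have h0: "remove_sings d s = 0" if "s \<in> A" for s
  proof (rule remove_sings_eqI)
    have "eventually (\<lambda>w. w \<in> A) (at s)"
      using A(1) that by (rule eventually_at_in_open')
    then have "eventually (\<lambda>w. 0 = d w) (at s)"
      by eventually_elim (simp add: d_def eq)
    then show "d \<midarrow>s\<rightarrow> 0"
      by (rule Lim_transform_eventually[OF tendsto_const])
  qed
  have "remove_sings d constant_on UNIV"
    by (rule constant_on_extend_nicely_meromorphic_on[OF h, of A])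
       (use A h0 in \<open>auto simp: constant_on_def\<close>)
  then have zero: "remove_sings d s = 0" for s
    using h0 A(2) unfolding constant_on_def by (metis ex_in_conv UNIV_I)
  have "eventually (\<lambda>w. remove_sings d w = d w) (at z)"
    using d by (intro eventually_remove_sings_eq_at meromorphic_on_isolated_singularity)
      (auto intro: meromorphic_on_subset)
  then have ev: "eventually (\<lambda>w. f w = g w) (at z)"
    by eventually_elim (use zero in \<open>simp add: d_def\<close>)
  have pole: "is_pole f z \<longleftrightarrow> is_pole g z"
    by (rule is_pole_cong[OF ev refl])
  show "f z = g z"
  proof (cases "is_pole f z")
    case True
    then have "\<not> f \<midarrow>z\<rightarrow> f z" "\<not> g \<midarrow>z\<rightarrow> g z"
      using pole not_tendsto_and_filterlim_at_infinity[of "at z"]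
      unfolding is_pole_def by (metis at_neq_bot)+
    then show ?thesis
      using f g unfolding nicely_meromorphic_on_def by (metis UNIV_I)
  next
    case False
    then have "f \<midarrow>z\<rightarrow> f z" "g \<midarrow>z\<rightarrow> g z"
      using f g pole unfolding nicely_meromorphic_on_def by auto
    moreover have "g \<midarrow>z\<rightarrow> f z"
      using \<open>f \<midarrow>z\<rightarrow> f z\<close> ev by (rule Lim_transform_eventually)
    ultimately show ?thesis
      using LIM_unique by blast
  qed
qed

lemma meromorphic_continuation_eqI:
  assumes "g nicely_meromorphic_on UNIV" "open A" "A \<noteq> {}" "\<And>s. s \<in> A \<Longrightarrow> g s = f s"
  shows "meromorphic_continuation A f = g"
  unfolding meromorphic_continuation_def
proof (rule the_equality)
  fix h assume "h nicely_meromorphic_on UNIV \<and> (\<forall>s\<in>A. h s = f s)"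
  then show "h = g"
    using assms by (intro nicely_meromorphic_eqI[of h g A]) auto
qed (use assms in auto)

end

theory Submission
  imports Defs
begin

text \<open>
  Let \<open>\<mu>\<close> be the probability measure on the line \<open>Re z = 1/2\<close> with density \<open>\<pi> / (2 cosh\<^sup>2 (\<pi> y))\<close> at
  \<open>z = 1/2 + i y\<close>. The reflection formula of the Gamma function gives
  \<open>\<integral> exp (- w z) d\<mu> = w / (exp w - 1)\<close> for \<open>\<bar>Im w\<bar> < 2 \<pi>\<close>. Put \<open>q = exp (- t)\<close> and \<open>h = 1 - q\<close>. Expanding
  \<open>(1 - exp (- t z)) powr (1 - s)\<close> by the binomial series and integrating termwise, one recognises the
  series that continues \<open>\<zeta>\<^sub>q\<close>: for \<open>t \<bar>Im s\<bar> < 2 \<pi>\<close>,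
  \<open>(s - 1) \<zeta>\<^sub>q(s) = (h / t) \<integral> exp (- t z (s - 1)) ((1 - exp (- t z)) / h) powr (1 - s) d\<mu>\<close>.
  The right-hand side has no singularity in \<open>s\<close>, and its integrand tends to \<open>z powr (1 - s)\<close> as \<open>t\<close> decreases
  to \<open>0\<close>, dominated by a multiple of \<open>exp (\<pi> \<bar>y\<bar>)\<close>. Hence \<open>\<zeta>\<^sub>q(s)\<close> tends to
  \<open>(1 / (s - 1)) \<integral> z powr (1 - s) d\<mu>\<close> for every \<open>s \<noteq> 1\<close>. For \<open>Re s > 1\<close> the defining series of \<open>\<zeta>\<^sub>q(s)\<close>
  tends to that of \<open>\<zeta>(s)\<close>, so the limit is the continuation of \<open>\<zeta>\<close>.
\<close>

subsection \<open>Holomorphic integrals and the negative binomial series\<close>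

text \<open>Cauchy's inequality on small discs turns the majorant \<open>g\<close> into the majorant
  \<open>g / r\<close> for the derivatives, hence for the difference quotients in \<open>s\<close>.
  Dominated convergence along sequences tending to \<open>s0\<close> then gives the complex
  derivative. With the counting measure this also covers series.\<close>

lemma holomorphic_on_lebesgue_integral:
  fixes f :: "complex \<Rightarrow> 'a \<Rightarrow> complex"
  assumes S: "open S"
    and hol: "\<And>x. x \<in> space M \<Longrightarrow> (\<lambda>s. f s x) holomorphic_on S"
    and meas: "\<And>s. s \<in> S \<Longrightarrow> f s \<in> borel_measurable M"
    and g: "integrable M g"
    and bound: "\<And>s x. s \<in> S \<Longrightarrow> x \<in> space M \<Longrightarrow> norm (f s x) \<le> g x"
  shows "(\<lambda>s. integral\<^sup>L M (f s)) holomorphic_on S"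
proof -
  have int: "integrable M (f s)" if "s \<in> S" for s
    by (rule Bochner_Integration.integrable_bound[OF g meas[OF that]])
       (use bound[OF that] in \<open>auto intro!: AE_I2 intro: order_trans[OF _ abs_ge_self]\<close>)
  have "\<exists>D. ((\<lambda>s. integral\<^sup>L M (f s)) has_field_derivative D) (at s0)" if s0: "s0 \<in> S" for s0
  proof -
    obtain e where e: "e > 0" "ball s0 e \<subseteq> S"
      using S s0 by (meson open_contains_ball)
    \<comment> \<open>A disc of radius e/3 around a point at distance at most e/3 from
      \<open>s0\<close> stays within 2e/3 of \<open>s0\<close>, so Cauchy's inequality applies at
      every point of \<open>cball s0 r\<close>.\<close>
    define r where "r = e / 3"
    have r: "r > 0" "cball s0 r \<subseteq> S" "\<And>s. s \<in> cball s0 r \<Longrightarrow> cball s r \<subseteq> S"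
    proof -
      show "r > 0" using e by (simp add: r_def)
      then show "cball s0 r \<subseteq> S"
        using e by (auto simp: r_def)
      fix s assume s: "s \<in> cball s0 r"
      have "w \<in> ball s0 e" if "w \<in> cball s r" for w
        using that s dist_triangle[of s0 w s] e(1) by (simp add: r_def dist_commute)
      then show "cball s r \<subseteq> S" using e(2) by blast
    qed
    have der: "((\<lambda>s. f s x) has_field_derivative deriv (\<lambda>s. f s x) s) (at s)"
      if "x \<in> space M" "s \<in> S" for x s
      using hol[OF that(1)] S that(2) by (rule holomorphic_derivI)
    have dbound: "norm (deriv (\<lambda>s. f s x) s) \<le> g x / r"
      if x: "x \<in> space M" and s: "s \<in> cball s0 r" for x s
    proof -
      have sub: "cball s r \<subseteq> S" by (rule r(3)[OF s])
      have "norm ((deriv ^^ 1) (\<lambda>s. f s x) s) \<le> fact 1 * g x / r ^ 1"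
      proof (rule Cauchy_inequality)
        show "(\<lambda>s. f s x) holomorphic_on ball s r"
          using hol[OF x] sub by (meson ball_subset_cball holomorphic_on_subset order_trans)
        show "continuous_on (cball s r) (\<lambda>s. f s x)"
          using hol[OF x] sub by (meson holomorphic_on_imp_continuous_on holomorphic_on_subset)
        show "norm (f w x) \<le> g x" if "cmod (s - w) = r" for w
        proof (rule bound[OF _ x])
          show "w \<in> S" using that sub by (auto simp: dist_norm)
        qed
      qed (use r in auto)
      then show ?thesis by simp
    qed
    have quot: "norm ((f s x - f s0 x) / (s - s0)) \<le> g x / r"
      if x: "x \<in> space M" and s: "s \<in> cball s0 r" "s \<noteq> s0" for x s
    proof -
      have "norm (f s x - f s0 x) \<le> g x / r * norm (s - s0)"
      proof (rule field_differentiable_bound[of "cball s0 r" "\<lambda>s. f s x" "deriv (\<lambda>s. f s x)"])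
        fix z assume z: "z \<in> cball s0 r"
        then show "((\<lambda>s. f s x) has_field_derivative deriv (\<lambda>s. f s x) z) (at z within cball s0 r)"
          using der[OF x] r(2) by (blast intro: has_field_derivative_at_within)
        show "norm (deriv (\<lambda>s. f s x) z) \<le> g x / r" by (rule dbound[OF x z])
      qed (use r(1) s in auto)
      then show ?thesis using s by (simp add: norm_divide field_simps)
    qed
    define D where "D = (\<lambda>x. deriv (\<lambda>s. f s x) s0)"
    have lim: "(\<lambda>n. integral\<^sup>L M (\<lambda>x. (f (X n) x - f s0 x) / (X n - s0))) \<longlonglongrightarrow> integral\<^sup>L M D"
      if X: "\<And>n. X n \<in> cball s0 r - {s0}" "X \<longlonglongrightarrow> s0" for X
    proof (rule integral_dominated_convergence[where w = "\<lambda>x. g x / r"])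
      have XS: "X n \<in> S" for n using X(1) r(2) by blast
      show m: "(\<lambda>x. (f (X n) x - f s0 x) / (X n - s0)) \<in> borel_measurable M" for n
        using meas[OF XS[of n]] meas[OF s0] by measurable
      have L: "(\<lambda>n. (f (X n) x - f s0 x) / (X n - s0)) \<longlonglongrightarrow> D x" if "x \<in> space M" for x
      proof -
        have "((\<lambda>s. (f s x - f s0 x) / (s - s0)) \<longlongrightarrow> D x) (at s0)"
          using der[OF that s0] by (simp add: has_field_derivative_iff D_def)
        then show ?thesis
          using X unfolding tendsto_at_iff_sequentially comp_def by auto
      qed
      then show "AE x in M. (\<lambda>n. (f (X n) x - f s0 x) / (X n - s0)) \<longlonglongrightarrow> D x" by auto
      show "D \<in> borel_measurable M"
        by (rule borel_measurable_LIMSEQ_metric[OF m L])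
      show "integrable M (\<lambda>x. g x / r)" using g by simp
      show "AE x in M. norm ((f (X n) x - f s0 x) / (X n - s0)) \<le> g x / r" for n
        using quot X(1)[of n] by (auto intro!: AE_I2)
    qed
    have "((\<lambda>s. (integral\<^sup>L M (f s) - integral\<^sup>L M (f s0)) / (s - s0)) \<longlongrightarrow> integral\<^sup>L M D)
       (at s0 within (cball s0 r))"
      unfolding tendsto_at_iff_sequentially comp_def
    proof (intro allI impI)
      fix X assume X: "\<forall>i. X i \<in> cball s0 r - {s0}" "X \<longlonglongrightarrow> s0"
      have "X n \<in> S" for n using X(1) r(2) by blast
      then have "integral\<^sup>L M (\<lambda>x. (f (X n) x - f s0 x) / (X n - s0)) =
         (integral\<^sup>L M (f (X n)) - integral\<^sup>L M (f s0)) / (X n - s0)" for n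
        using int s0 by simp
      with lim[of X] X show "(\<lambda>n. (integral\<^sup>L M (f (X n)) - integral\<^sup>L M (f s0)) / (X n - s0))
           \<longlonglongrightarrow> integral\<^sup>L M D" by simp
    qed
    moreover have "at s0 within cball s0 r = at s0"
      using r(1) by (intro at_within_interior) auto
    ultimately show ?thesis by (auto simp: has_field_derivative_iff)
  qed
  then show ?thesis
    using S by (auto simp: holomorphic_on_open)
qed

lemma neg_binomial_coeff:
  fixes b :: "'a :: field_char_0"
  shows "((-b) gchoose r) * (-1) ^ r = pochhammer b r / fact r"
  by (simp add: gbinomial_pochhammer mult_ac flip: power_mult_distrib)

lemma neg_binomial_sums:
  fixes b v :: complex
  assumes "norm v < 1"
  shows "(\<lambda>r. pochhammer b r / fact r * v ^ r) sums (1 - v) powr (-b)"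
proof -
  have "((-b) gchoose r) * (-v) ^ r = pochhammer b r / fact r * v ^ r" for r
    by (simp add: neg_binomial_coeff[symmetric] power_minus[of v])
  then show ?thesis
    using gen_binomial_complex[of "-v" "-b"] assms by simp
qed

lemma norm_pochhammer_le:
  fixes b :: complex
  assumes "norm b \<le> R"
  shows "norm (pochhammer b r) \<le> pochhammer R r"
  unfolding pochhammer_prod prod_norm[symmetric]
proof (rule prod_mono)
  fix i assume "i \<in> {0..<r}"
  show "0 \<le> norm (b + of_nat i) \<and> norm (b + of_nat i) \<le> R + of_nat i"
    using norm_triangle_ineq[of b "of_nat i"] assms by simp
qed

lemma summable_pochhammer:
  fixes R \<rho> :: real
  assumes "0 \<le> \<rho>" "\<rho> < 1"
  shows "summable (\<lambda>r. pochhammer R r / fact r * \<rho> ^ r)"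
proof -
  have "((-R) gchoose r) * (-\<rho>) ^ r = pochhammer R r / fact r * \<rho> ^ r" for r
    by (simp add: neg_binomial_coeff[symmetric] power_minus[of \<rho>])
  then show ?thesis
    using gen_binomial_real[of "-\<rho>" "-R"] assms by (simp add: sums_iff)
qed

text \<open>The majorant is the series of (1 - \<rho>)^(-R), which has nonnegative terms and is the
  same for all \<open>b\<close> in the disc of radius \<open>R\<close>.\<close>

lemma norm_neg_binomial_term_le:
  fixes b v :: complex
  assumes "norm b \<le> R" "norm v \<le> \<rho>"
  shows "norm (pochhammer b r / fact r * v ^ r) \<le> pochhammer R r / fact r * \<rho> ^ r"
  unfolding norm_mult norm_divide norm_power norm_fact
proof (intro mult_mono divide_right_mono power_mono norm_pochhammer_le assms)
  have "0 \<le> pochhammer R r"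
    by (rule order_trans[OF norm_ge_zero norm_pochhammer_le[OF assms(1)]])
  then show "0 \<le> pochhammer R r / fact r" by simp
qed auto

text \<open>Since |v| stays below a fixed \<rho> < 1, the expanded terms are dominated by |a| times
  a summable sequence, so sum and integral may be exchanged. Used twice: with the counting measure
  for the defining series, and with \<open>bern_measure\<close> for the integral
  representation.\<close>

lemma
  fixes a v :: "'a \<Rightarrow> complex"
  assumes a: "integrable M a" and v[measurable]: "v \<in> borel_measurable M"
    and bound: "\<And>x. x \<in> space M \<Longrightarrow> norm (v x) \<le> \<rho>" and \<rho>: "0 \<le> \<rho>" "\<rho> < 1"
  shows neg_binomial_integrable: "integrable M (\<lambda>x. a x * (1 - v x) powr (-b))"
    and neg_binomial_integral: "(\<lambda>r. pochhammer b r / fact r * (\<integral>x. a x * v x ^ r \<partial>M)) sums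
           (\<integral>x. a x * (1 - v x) powr (-b) \<partial>M)"
proof -
  have [measurable]: "a \<in> borel_measurable M" using a by simp
  define f where "f = (\<lambda>r x. a x * (pochhammer b r / fact r * v x ^ r))"
  define p where "p = (\<lambda>r. pochhammer (norm b) r / fact r * \<rho> ^ r)"
  have p: "summable p"
    unfolding p_def using \<rho> by (rule summable_pochhammer)
  have p0: "p r \<ge> 0" for r
    unfolding p_def using \<rho>
    by (intro order_trans[OF norm_ge_zero norm_neg_binomial_term_le[of b _ "of_real \<rho>"]]) auto
  have fb: "norm (f r x) \<le> norm (a x) * p r" if "x \<in> space M" for r x
    unfolding f_def p_def norm_mult[of "a x"]
    by (intro mult_left_mono norm_neg_binomial_term_le bound that) auto
  have f_int: "integrable M (f r)" for r
  proof (rule Bochner_Integration.integrable_bound)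
    show "integrable M (\<lambda>x. norm (a x) * p r)" using a by simp
    show "f r \<in> borel_measurable M" unfolding f_def by measurable
    show "AE x in M. norm (f r x) \<le> norm (norm (a x) * p r)"
      using fb p0 by (auto intro!: AE_I2)
  qed
  have AE_sum: "AE x in M. summable (\<lambda>r. norm (f r x))"
  proof (rule AE_I2)
    fix x assume "x \<in> space M"
    then show "summable (\<lambda>r. norm (f r x))"
      using fb by (intro summable_comparison_test'[OF summable_mult[OF p, of "norm (a x)"], of 0]) simp
  qed
  have int_sum: "summable (\<lambda>r. \<integral>x. norm (f r x) \<partial>M)"
  proof -
    have "norm (\<integral>x. norm (f r x) \<partial>M) \<le> (\<integral>x. norm (a x) \<partial>M) * p r" for r
    proof -
      have "(\<integral>x. norm (f r x) \<partial>M) \<le> (\<integral>x. norm (a x) * p r \<partial>M)"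
        using fb f_int a by (intro integral_mono) auto
      then show ?thesis by simp
    qed
    then show ?thesis
      by (rule summable_comparison_test'[OF summable_mult[OF p], of 0])
  qed
  have suminf: "(\<Sum>r. f r x) = a x * (1 - v x) powr (-b)" if "x \<in> space M" for x
    using sums_mult[OF neg_binomial_sums[of "v x" b], of "a x"] bound[OF that] \<rho>
    by (simp add: f_def sums_iff)
  show "integrable M (\<lambda>x. a x * (1 - v x) powr (-b))"
    using integrable_suminf[OF f_int AE_sum int_sum]
    by (subst Bochner_Integration.integrable_cong[OF refl suminf[symmetric]])
  have "(\<lambda>r. integral\<^sup>L M (f r)) sums (\<integral>x. (\<Sum>r. f r x) \<partial>M)"
    by (rule sums_integral[OF f_int AE_sum int_sum])
  moreover have "(\<integral>x. (\<Sum>r. f r x) \<partial>M) = (\<integral>x. a x * (1 - v x) powr (-b) \<partial>M)"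
    using suminf by (intro Bochner_Integration.integral_cong) auto
  moreover have "integral\<^sup>L M (f r) = pochhammer b r / fact r * (\<integral>x. a x * v x ^ r \<partial>M)" for r
    by (subst integral_mult_right_zero[symmetric]) (simp add: f_def mult_ac)
  ultimately show "(\<lambda>r. pochhammer b r / fact r * (\<integral>x. a x * v x ^ r \<partial>M)) sums
           (\<integral>x. a x * (1 - v x) powr (-b) \<partial>M)" by simp
qed

subsection \<open>The logistic measure on the line Re z = 1/2\<close>

lemma (in pair_sigma_finite) product_integral:
  fixes f :: "'a \<Rightarrow> 'c :: {real_normed_field, banach, second_countable_topology}"
    and g :: "'b \<Rightarrow> 'c"
  assumes f: "integrable M1 f" and g: "integrable M2 g"
  shows "integrable (M1 \<Otimes>\<^sub>M M2) (\<lambda>p. f (fst p) * g (snd p))"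
    and "(\<integral>p. f (fst p) * g (snd p) \<partial>(M1 \<Otimes>\<^sub>M M2)) = integral\<^sup>L M1 f * integral\<^sup>L M2 g"
proof -
  have [measurable]: "f \<in> borel_measurable M1" "g \<in> borel_measurable M2"
    using f g by auto
  show *: "integrable (M1 \<Otimes>\<^sub>M M2) (\<lambda>p. f (fst p) * g (snd p))"
    by (rule Fubini_integrable) (use f g in \<open>auto simp: norm_mult\<close>)
  show "(\<integral>p. f (fst p) * g (snd p) \<partial>(M1 \<Otimes>\<^sub>M M2)) = integral\<^sup>L M1 f * integral\<^sup>L M2 g"
    using integral_fst'[OF *] f g by simp
qed

definition std_exp :: "real measure" where
  "std_exp = density lborel (\<lambda>x. ennreal (indicator {0<..} x * exp (- x)))"

lemma sets_std_exp [measurable_cong, simp]: "sets std_exp = sets borel"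
  and space_std_exp [simp]: "space std_exp = UNIV"
  by (simp_all add: std_exp_def)

text \<open>This is Euler's integral with x^(b-1) written as an exponential of \<open>ln x\<close>;
  the density vanishes for x <= 0. Borel measurability of the integrand allows the passage from
  \<open>lebesgue\<close> to \<open>lborel\<close>.\<close>

lemma has_bochner_integral_std_exp_Gamma:
  assumes "Re b > 0"
  shows "has_bochner_integral std_exp (\<lambda>x. exp ((b - 1) * of_real (ln x))) (Gamma b)"
proof -
  define f where "f = (\<lambda>x. complex_of_real x powr (b - 1) / of_real (exp x))"
  define k where "k = (\<lambda>x. (indicator {0<..} x * exp (- x)) *\<^sub>R exp ((b - 1) * of_real (ln x)) :: complex)"
  have kf: "k = (\<lambda>x. indicator {0<..} x *\<^sub>R f x)"
    by (auto simp: fun_eq_iff k_def f_def powr_def indicator_def exp_minus field_simps scaleR_conv_of_real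
        simp flip: Ln_of_real)
  have [measurable]: "k \<in> borel_measurable borel"
    unfolding k_def by measurable
  have abs: "f absolutely_integrable_on {0<..}"
    unfolding f_def by (rule absolutely_integrable_Gamma_integral'[OF assms])
  then have "integrable lebesgue k"
    by (simp add: set_integrable_def kf)
  then have 1: "integrable lborel k"
    by (subst (asm) integrable_completion) auto
  have "integral\<^sup>L lebesgue k = integral {0<..} f"
    using set_lebesgue_integral_eq_integral(2)[OF abs] by (simp add: set_lebesgue_integral_def kf)
  also have "\<dots> = Gamma b"
    unfolding f_def by (rule integral_unique[OF Gamma_integral_complex'[OF assms]])
  finally have 2: "integral\<^sup>L lborel k = Gamma b"
    by (subst (asm) integral_completion) auto
  have "integrable std_exp (\<lambda>x. exp ((b - 1) * of_real (ln x)))"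
    unfolding std_exp_def by (subst integrable_density) (use 1 in \<open>auto simp: k_def\<close>)
  moreover have "(\<integral>x. exp ((b - 1) * of_real (ln x)) \<partial>std_exp) = Gamma b"
    unfolding std_exp_def by (subst integral_density) (use 2 in \<open>auto simp: k_def\<close>)
  ultimately show ?thesis by (simp add: has_bochner_integral_iff)
qed

interpretation std_exp: finite_measure std_exp
proof (rule finite_measureI)
  \<comment> \<open>The case b = 1 of the Gamma integral: the constant 1 is integrable, so the total
    mass is finite.\<close>
  have "integrable std_exp (\<lambda>_. 1 :: complex)"
    using has_bochner_integral_std_exp_Gamma[of 1] by (simp add: has_bochner_integral_iff)
  then show "emeasure std_exp (space std_exp) \<noteq> \<infinity>"
    by (auto simp: integrable_iff_bounded)
qed

interpretation std_exp2: pair_sigma_finite std_exp std_exp ..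

text \<open>The logarithm of the ratio of two independent exponential variables is logistic, so
  \<open>bern_pt\<close> is distributed on the line \<open>Re z = 1/2\<close> with density \<open>\<pi> / (2 cosh\<^sup>2 (\<pi> y))\<close>. Keeping the
  two variables apart turns the integral of \<open>exp (- w z)\<close> into a product of two Gamma integrals.\<close>

definition bern_measure :: "(real \<times> real) measure" where
  "bern_measure = std_exp \<Otimes>\<^sub>M std_exp"

definition bern_pt :: "real \<times> real \<Rightarrow> complex" where
  "bern_pt p = Complex (1/2) ((ln (fst p) - ln (snd p)) / (2 * pi))"

lemma space_bern_measure [simp]: "space bern_measure = UNIV"
  by (simp add: bern_measure_def space_pair_measure)

lemma Re_bern_pt [simp]: "Re (bern_pt p) = 1/2"
  by (simp add: bern_pt_def)

lemma measurable_bern_pt [measurable]: "bern_pt \<in> borel_measurable bern_measure"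
  unfolding bern_pt_def bern_measure_def Complex_eq by measurable

text \<open>With a = i w / (2 pi) and coordinates X, Y of \<open>p\<close>, the integrand is
  exp(-w/2) X^(-a) Y^a. Both Gamma integrals converge when |Re a| < 1, which is the strip |Im w| < 2
  pi.\<close>

lemma has_bochner_integral_exp_bern_pt:
  assumes "\<bar>Im w\<bar> < 2 * pi"
  shows "has_bochner_integral bern_measure (\<lambda>p. exp (- w * bern_pt p))
     (exp (- w / 2) * Gamma (1 - \<i> * w / (2 * pi)) * Gamma (1 + \<i> * w / (2 * pi)))"
proof -
  define a where "a = \<i> * w / (2 * pi)"
  have "\<bar>Re a\<bar> < 1"
    using assms by (simp add: a_def)
  then have re: "Re (1 - a) > 0" "Re (1 + a) > 0" by auto
  define f where "f = (\<lambda>x. exp (- w / 2) * exp ((1 - a - 1) * complex_of_real (ln x)))"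
  define g where "g = (\<lambda>x. exp ((1 + a - 1) * complex_of_real (ln x)))"
  note F = has_bochner_integral_std_exp_Gamma[OF re(1)]
  note G = has_bochner_integral_std_exp_Gamma[OF re(2)]
  have f: "integrable std_exp f" "integral\<^sup>L std_exp f = exp (- w / 2) * Gamma (1 - a)"
    and g: "integrable std_exp g" "integral\<^sup>L std_exp g = Gamma (1 + a)"
    using F G by (auto simp: f_def g_def has_bochner_integral_iff)
  have eq: "f (fst p) * g (snd p) = exp (- w * bern_pt p)" for p
  proof -
    have "- w * bern_pt p = - w / 2 + ((1 - a - 1) * of_real (ln (fst p)) + (1 + a - 1) * of_real (ln (snd p)))"
      by (simp add: bern_pt_def a_def Complex_eq field_simps)
    then show ?thesis
      by (simp only: f_def g_def exp_add mult.assoc)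
  qed
  show ?thesis
    using std_exp2.product_integral[OF f(1) g(1)] f(2) g(2)
    by (simp add: eq has_bochner_integral_iff bern_measure_def a_def)
qed

lemma integral_exp_bern_pt:
  assumes w: "\<bar>Im w\<bar> < 2 * pi" "w \<noteq> 0"
  shows "(\<integral>p. exp (- w * bern_pt p) \<partial>bern_measure) = w / (exp w - 1)"
proof -
  define a where "a = \<i> * w / (2 * pi)"
  have a: "\<bar>Re a\<bar> < 1" "a \<noteq> 0"
    using w by (auto simp: a_def)
  \<comment> \<open>The recurrence Gamma (1 + a) = a Gamma a requires this. As |Re a| < 1, the only
    candidate is 0, which w \<noteq> 0 excludes; at w = 0 the integral would be 1, while the
    quotient 0 / 0 is 0.\<close>
  have "a \<notin> \<int>\<^sub>\<le>\<^sub>0"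
  proof
    assume "a \<in> \<int>\<^sub>\<le>\<^sub>0"
    then obtain n where n: "a = - of_nat n" by (auto elim: nonpos_Ints_cases')
    then show False using a by (cases n) auto
  qed
  then have "Gamma (1 - a) * Gamma (1 + a) = a * (Gamma a * Gamma (1 - a))"
    by (simp add: Gamma_plus1[of a] add.commute[of 1])
  also have "\<dots> = a * (of_real pi / sin (of_real pi * a))"
    by (simp add: Gamma_reflection_complex)
  also have "sin (of_real pi * a) = (exp (- w / 2) - exp (w / 2)) / (2 * \<i>)"
    by (simp add: sin_exp_eq a_def)
  also have "a * (of_real pi / ((exp (- w / 2) - exp (w / 2)) / (2 * \<i>))) =
      (a * of_real pi * (2 * \<i>)) / (exp (- w / 2) - exp (w / 2))"
    by (simp only: divide_divide_eq_right times_divide_eq_right mult.assoc)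
  also have "a * of_real pi * (2 * \<i>) = - w"
    by (simp add: a_def mult.commute[of w])
  also have "- w / (exp (- w / 2) - exp (w / 2)) = w / (exp (w / 2) - exp (- w / 2))"
    by (metis minus_diff_eq minus_divide_divide minus_minus)
  finally have G: "Gamma (1 - a) * Gamma (1 + a) = w / (exp (w / 2) - exp (- w / 2))" .
  have "exp (- w / 2) = inverse (exp (w / 2))"
    by (metis exp_minus minus_divide_left)
  then have "exp (- w / 2) * (Gamma (1 - a) * Gamma (1 + a)) =
      inverse (exp (w / 2)) * (w / (exp (w / 2) - exp (- w / 2)))"
    by (simp only: G)
  also have "\<dots> = w / (exp (w / 2) * (exp (w / 2) - exp (- w / 2)))"
    by (simp only: divide_inverse inverse_mult_distrib mult_ac)
  also have "exp (w / 2) * (exp (w / 2) - exp (- w / 2)) = exp w - 1"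
    by (simp add: right_diff_distrib flip: exp_add)
  finally show ?thesis
    using has_bochner_integral_exp_bern_pt[OF w(1)]
    by (simp add: has_bochner_integral_iff a_def mult.assoc)
qed

text \<open>In the coordinates X, Y the exponent is |ln X - ln Y| / 2, so the integrand is at most a
  product of factors x^(1/2) + x^(-1/2). These have finite integrals because both exponents exceed
  -1.\<close>

lemma integrable_exp_Im_bern_pt: "integrable bern_measure (\<lambda>p. exp (pi * \<bar>Im (bern_pt p)\<bar>))"
proof -
  define c where "c = (\<lambda>x::real. exp (ln x / 2) + exp (- ln x / 2))"
  have [measurable]: "c \<in> borel_measurable borel" unfolding c_def by measurable
  have c0: "c x > 0" for x by (simp add: c_def add_pos_pos)
  have re: "integrable std_exp (\<lambda>x. exp (b * ln x))" if "b > -1" for b :: real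
  proof -
    have "integrable std_exp (\<lambda>x. exp ((of_real (b + 1) - 1) * complex_of_real (ln x)))"
      using has_bochner_integral_std_exp_Gamma[of "of_real (b + 1)"] that
      by (auto simp: has_bochner_integral_iff)
    from integrable_norm[OF this] show ?thesis by simp
  qed
  have c: "integrable std_exp c"
    unfolding c_def using re[of "1/2"] re[of "-1/2"] by (intro Bochner_Integration.integrable_add) auto
  have int: "integrable bern_measure (\<lambda>p. c (fst p) * c (snd p))"
    unfolding bern_measure_def by (rule std_exp2.product_integral[OF c c])
  show ?thesis
  proof (rule Bochner_Integration.integrable_bound[OF int])
    have "exp (pi * \<bar>Im (bern_pt p)\<bar>) \<le> c (fst p) * c (snd p)" for p
    proof -
      have "pi * \<bar>Im (bern_pt p)\<bar> = \<bar>ln (fst p) - ln (snd p)\<bar> / 2"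
        by (simp add: bern_pt_def abs_divide)
      also have "\<dots> \<le> \<bar>ln (fst p)\<bar> / 2 + \<bar>ln (snd p)\<bar> / 2" by simp
      finally have "exp (pi * \<bar>Im (bern_pt p)\<bar>) \<le> exp (\<bar>ln (fst p)\<bar> / 2) * exp (\<bar>ln (snd p)\<bar> / 2)"
        by (simp flip: exp_add)
      also have "\<dots> \<le> c (fst p) * c (snd p)"
        by (intro mult_mono) (auto simp: c_def abs_if intro: add_nonneg_nonneg)
      finally show ?thesis .
    qed
    then show "AE p in bern_measure. norm (exp (pi * \<bar>Im (bern_pt p)\<bar>)) \<le> norm (c (fst p) * c (snd p))"
      using c0 by (auto simp: abs_mult less_imp_le)
  qed measurable
qed

subsection \<open>Continuation of the q-zeta function\<close>

text \<open>For q = exp(-t) the quotient q^x / (1 - q^x) equals 1 / (exp (t x) - 1). Where that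
  denominator is 0 the quotient defaults to 0, so at such points \<open>q_zeta_binom\<close> need
  not have the continued value; \<open>remove_sings\<close> repairs this later.\<close>

definition binom_term :: "real \<Rightarrow> complex \<Rightarrow> nat \<Rightarrow> complex" where
  "binom_term t s r = pochhammer s r / fact r / (exp (of_real t * (s - 1 + of_nat r)) - 1)"

definition q_zeta_binom :: "real \<Rightarrow> complex \<Rightarrow> complex" where
  "q_zeta_binom t s = of_real (1 - exp (- t)) powr s * (\<Sum>r. binom_term t s r)"

text \<open>From index \<open>N\<close> on, the real part of s - 1 + (r + N) is at least r +
  \<delta>, so the denominator is at least exp(t r) (exp(t \<delta>) - 1). Writing exp(-t r) as a
  power with exponent r + N costs the constant exp(t N).\<close>

lemma norm_binom_term_le:
  assumes t: "t > 0" and \<delta>: "\<delta> > 0" and s: "norm s \<le> R" "Re s \<ge> 1 - real N + \<delta>"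
  shows "norm (binom_term t s (r + N)) \<le>
    pochhammer R (r + N) / fact (r + N) * exp (- t) ^ (r + N) * (exp (t * real N) / (exp (t * \<delta>) - 1))"
    and "exp (of_real t * (s - 1 + of_nat (r + N))) \<noteq> 1"
proof -
  define w where "w = of_real t * (s - 1 + of_nat (r + N))"
  have pos: "exp (t * \<delta>) - 1 > 0" using t \<delta> by simp
  have "Re w = t * (Re s - 1 + real (r + N))"
    by (simp add: w_def)
  moreover have "real r + \<delta> \<le> Re s - 1 + real (r + N)"
    using s(2) by simp
  ultimately have "t * (real r + \<delta>) \<le> Re w"
    using t by (simp only: mult_left_mono less_imp_le)
  then have "exp (t * real r + t * \<delta>) \<le> norm (exp w)"
    by (simp add: distrib_left)
  then have "exp (t * real r) * exp (t * \<delta>) \<le> norm (exp w)"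
    by (simp only: exp_add)
  also have "norm (exp w) \<le> norm (exp w - 1) + 1"
    using norm_triangle_ineq[of "exp w - 1" 1] by simp
  finally have "exp (t * real r) * exp (t * \<delta>) - 1 \<le> norm (exp w - 1)" by simp
  moreover have "exp (t * real r) \<ge> 1" using t by simp
  ultimately have den: "exp (t * real r) * (exp (t * \<delta>) - 1) \<le> norm (exp w - 1)"
    by (simp only: right_diff_distrib mult_1_right)
  moreover have "exp (t * real r) * (exp (t * \<delta>) - 1) > 0" using pos by simp
  ultimately show "exp w \<noteq> 1" by auto
  have "norm (binom_term t s (r + N)) = norm (pochhammer s (r + N)) / fact (r + N) / norm (exp w - 1)"
    unfolding binom_term_def w_def[symmetric] norm_divide norm_fact by simp
  also have "\<dots> \<le> pochhammer R (r + N) / fact (r + N) / (exp (t * real r) * (exp (t * \<delta>) - 1))"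
    using pos by (intro frac_le divide_right_mono norm_pochhammer_le s den)
      (auto intro!: divide_nonneg_nonneg order_trans[OF norm_ge_zero norm_pochhammer_le[OF s(1)]])
  also have "\<dots> = pochhammer R (r + N) / fact (r + N) *
      exp (- t) ^ (r + N) * (exp (t * real N) / (exp (t * \<delta>) - 1))"
  proof -
    have "exp (- t) ^ (r + N) * exp (t * real N) = inverse (exp (t * real r))"
      by (simp add: algebra_simps exp_minus[symmetric] flip: exp_of_nat_mult exp_add)
    then show ?thesis by (simp add: divide_inverse mult_ac)
  qed
  finally show "norm (binom_term t s (r + N)) \<le> \<dots>" .
qed

lemma binom_term_tail:
  fixes t \<delta> R :: real and N :: nat
  assumes t: "t > 0" and \<delta>: "\<delta> > 0"
  defines "S \<equiv> {s. norm s < R \<and> Re s > 1 - real N + \<delta>}"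
  shows "\<And>s. s \<in> S \<Longrightarrow> summable (\<lambda>r. norm (binom_term t s (r + N)))"
    and "(\<lambda>s. \<Sum>r. binom_term t s (r + N)) holomorphic_on S"
proof -
  define g where "g = (\<lambda>r. pochhammer R (r + N) / fact (r + N) *
      exp (- t) ^ (r + N) * (exp (t * real N) / (exp (t * \<delta>) - 1)))"
  have "summable (\<lambda>r. pochhammer R (r + N) / fact (r + N) * exp (- t) ^ (r + N))"
    using summable_pochhammer[of "exp (- t)" R] t by (subst summable_iff_shift) auto
  then have g: "summable g"
    unfolding g_def by (rule summable_mult2)
  have bound: "norm (binom_term t s (r + N)) \<le> g r" if "s \<in> S" for s r
    unfolding g_def using that by (intro norm_binom_term_le t \<delta>) (auto simp: S_def)
  show sum: "summable (\<lambda>r. norm (binom_term t s (r + N)))" if "s \<in> S" for s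
    using bound[OF that] by (intro summable_comparison_test'[OF g, of 0]) simp
  have "open S"
    unfolding S_def by (intro open_Collect_conj open_Collect_less continuous_intros)
  show "(\<lambda>s. \<Sum>r. binom_term t s (r + N)) holomorphic_on S"
  \<comment> \<open>Nonnegativity of \<open>g\<close> is read off from the bound at some point of
    \<open>S\<close>, so the empty set is treated apart.\<close>
  proof (cases "S = {}")
    case False
    have "(\<lambda>s. integral\<^sup>L (count_space UNIV) (\<lambda>r. binom_term t s (r + N))) holomorphic_on S"
    proof (rule holomorphic_on_lebesgue_integral[OF \<open>open S\<close>, where g = g])
      show "(\<lambda>s. binom_term t s (r + N)) holomorphic_on S" for r
        unfolding binom_term_def pochhammer_prod
      proof (intro holomorphic_intros)
        fix s assume "s \<in> S"
        then show "exp (of_real t * (s - 1 + of_nat (r + N))) - 1 \<noteq> 0"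
          using norm_binom_term_le(2)[OF t \<delta>, of s R N r] by (auto simp: S_def)
      qed auto
      show "integrable (count_space UNIV) g"
      proof -
        have "g r \<ge> 0" for r
          using bound False by (meson all_not_in_conv norm_ge_zero order_trans)
        then show ?thesis
          using g by (simp add: integrable_count_space_nat_iff)
      qed
      show "norm (binom_term t s (r + N)) \<le> g r" if "s \<in> S" for s r
        by (rule bound[OF that])
    qed auto
    moreover have "integral\<^sup>L (count_space UNIV) (\<lambda>r. binom_term t s (r + N)) =
        (\<Sum>r. binom_term t s (r + N))" if "s \<in> S" for s
      using sum[OF that] by (intro integral_count_space_nat) (simp add: integrable_count_space_nat_iff)
    ultimately show ?thesis
      by (rule holomorphic_transform)
  qed (simp add: holomorphic_on_empty)
qed

text \<open>Locally only finitely many terms can be singular: the first \<open>N\<close> terms are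
  meromorphic, and the tail is holomorphic.\<close>

lemma meromorphic_q_zeta_binom:
  assumes t: "t > 0"
  shows "q_zeta_binom t meromorphic_on UNIV"
proof -
  have "q_zeta_binom t meromorphic_on {s}" for s
  proof -
    define R where "R = norm s + 1"
    \<comment> \<open>This makes 2 - N < -R, so the half-plane in \<open>S\<close> contains every
      point of norm below \<open>R\<close>.\<close>
    obtain N where N: "real N > R + 2"
      using reals_Archimedean2 by blast
    define S where "S = {s. norm s < R \<and> Re s > 1 - real N + 1}"
    note tail = binom_term_tail[OF t zero_less_one, where R = R and N = N, folded S_def]
    have "open S"
      unfolding S_def by (intro open_Collect_conj open_Collect_less continuous_intros)
    have "s \<in> S"
      using N abs_Re_le_cmod[of s] by (auto simp: S_def R_def)
    have "(\<lambda>s. of_real (1 - exp (- t)) powr s *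
        ((\<Sum>r. binom_term t s (r + N)) + (\<Sum>r<N. binom_term t s r))) meromorphic_on S"
    proof (intro meromorphic_intros)
      show "(\<lambda>s. \<Sum>r. binom_term t s (r + N)) meromorphic_on S"
        using tail(2) \<open>open S\<close> by (intro analytic_on_imp_meromorphic_on) (simp add: analytic_on_open)
      show "(\<lambda>s. of_real (1 - exp (- t)) powr s) meromorphic_on S"
        using t by (intro analytic_on_imp_meromorphic_on) (auto intro!: analytic_intros simp: complex_nonpos_Reals_iff)
      show "(\<lambda>s. binom_term t s r) meromorphic_on S" for r
      proof -
        have "(\<lambda>s. exp (of_real t * (s - 1 + of_nat r))) meromorphic_on S"
          by (intro analytic_on_imp_meromorphic_on analytic_intros)
        then show ?thesis
          unfolding binom_term_def pochhammer_prod by (intro meromorphic_intros)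
      qed
    qed
    also have "?this \<longleftrightarrow> q_zeta_binom t meromorphic_on S"
    proof (rule meromorphic_on_cong[OF _ refl])
      fix z assume z: "z \<in> S"
      have "eventually (\<lambda>w. w \<in> S) (at z)"
        using \<open>open S\<close> z by (rule eventually_at_in_open')
      then show "eventually (\<lambda>s. of_real (1 - exp (- t)) powr s *
        ((\<Sum>r. binom_term t s (r + N)) + (\<Sum>r<N. binom_term t s r)) = q_zeta_binom t s) (at z)"
      proof eventually_elim
        case (elim w)
        then have "summable (binom_term t w)"
          using tail(1)[OF elim] by (subst summable_iff_shift[symmetric, of _ N]) (rule summable_norm_cancel)
        then show ?case
          unfolding q_zeta_binom_def by (subst suminf_split_initial_segment[of _ N]) auto
      qed
    qed
    finally show ?thesis
      using \<open>s \<in> S\<close> by (auto intro: meromorphic_on_subset)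
  qed
  then show ?thesis
    by (subst meromorphic_on_meromorphic_at) auto
qed

text \<open>To the right of Re s = 1 no denominator vanishes, so the tail estimate applies with N =
  0; \<delta> is half the distance of \<open>s\<close> from that line.\<close>

lemma analytic_q_zeta_binom:
  assumes t: "t > 0" and s: "Re s > 1"
  shows "q_zeta_binom t analytic_on {s}"
proof -
  define \<delta> where "\<delta> = (Re s - 1) / 2"
  have \<delta>: "\<delta> > 0" using s by (simp add: \<delta>_def)
  define S where "S = {z. norm z < norm s + 1 \<and> Re z > 1 - real 0 + \<delta>}"
  have "open S"
    unfolding S_def by (intro open_Collect_conj open_Collect_less continuous_intros)
  have "s \<in> S" using s by (simp add: S_def \<delta>_def field_simps)
  have "q_zeta_binom t holomorphic_on S"
    unfolding q_zeta_binom_def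
    using binom_term_tail(2)[OF t \<delta>, where R = "norm s + 1" and N = 0, folded S_def] t
    by (auto intro!: holomorphic_intros simp: complex_nonpos_Reals_iff)
  with \<open>open S\<close> \<open>s \<in> S\<close> show ?thesis
    by (meson analytic_at)
qed

text \<open>Expand (1 - q^n)^(-s) by the binomial series and exchange the two sums. The sum over n
  is then geometric with ratio q^(s-1+r). Indices start at 0 here, hence the exponents
  \<open>Suc n\<close>.\<close>

lemma q_zeta_series_eq_binom:
  assumes t: "t > 0" and s: "Re s > 1"
  shows "q_zeta_series (exp (- t)) s = q_zeta_binom t s"
proof -
  define h where "h = 1 - exp (- t)"
  have h: "h > 0" using t by (simp add: h_def)
  define a where "a = (\<lambda>n. exp (- of_real t * (s - 1)) ^ Suc n)"
  define v where "v = (\<lambda>n. complex_of_real (exp (- t)) ^ Suc n)"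
  define M :: "nat measure" where "M = count_space UNIV"
  have norm_pow: "norm (exp (- of_real t * (s - 1) :: complex)) < 1"
    using t s by simp
  have a: "integrable M a"
    unfolding M_def a_def integrable_count_space_nat_iff norm_power
    using norm_pow by (subst summable_Suc_iff) (auto intro!: summable_geometric)
  have powr: "of_real (exp (- t)) powr (of_nat n * (s - 1)) = exp (- of_real t * (s - 1)) ^ n" for n
    by (simp add: powr_def Ln_of_real flip: exp_of_real exp_of_nat_mult) (simp add: mult_ac)?
  have v: "norm (v n) \<le> exp (- t)" for n
    using t unfolding v_def norm_power by (simp add: mult_left_le power_le_one)
  have "(\<lambda>r. pochhammer s r / fact r * (\<integral>n. a n * v n ^ r \<partial>M)) sums
      (\<integral>n. a n * (1 - v n) powr (- s) \<partial>M)"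
    by (rule neg_binomial_integral[OF a _ v]) (use t in \<open>auto simp: M_def\<close>)
  moreover have "(\<integral>n. a n * v n ^ r \<partial>M) = 1 / (exp (of_real t * (s - 1 + of_nat r)) - 1)" for r
  proof -
    define E where "E = exp (- of_real t * (s - 1 + of_nat r))"
    have E: "norm E < 1"
      using t s by (simp add: E_def)
    have eq: "a n * v n ^ r = E ^ Suc n" for n
      by (simp add: a_def v_def E_def of_real_exp algebra_simps flip: exp_of_nat_mult exp_add)
    have "integrable M (\<lambda>n. E ^ Suc n)"
      unfolding M_def integrable_count_space_nat_iff norm_power
      using E by (subst summable_Suc_iff) (auto intro!: summable_geometric)
    then have "(\<integral>n. E ^ Suc n \<partial>M) = (\<Sum>n. E ^ Suc n)"
      unfolding M_def by (rule integral_count_space_nat)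
    also have "\<dots> = E / (1 - E)"
      using sums_mult[OF geometric_sums[OF E], of E] by (simp add: sums_iff)
    also have "\<dots> = 1 / (inverse E - 1)"
      using E by (simp add: E_def field_simps)
    finally show ?thesis
      by (simp add: eq E_def exp_minus)
  qed
  ultimately have 1: "(\<integral>n. a n * (1 - v n) powr (- s) \<partial>M) = (\<Sum>r. binom_term t s r)"
    by (simp add: sums_iff binom_term_def)
  have int: "integrable M (\<lambda>n. a n * (1 - v n) powr (- s))"
    by (rule neg_binomial_integrable[OF a _ v]) (use t in \<open>auto simp: M_def\<close>)
  have "q_zeta_series (exp (- t)) s = (\<Sum>n. of_real h powr s * (a n * (1 - v n) powr (- s)))"
    unfolding q_zeta_series_def Let_def
  proof (intro suminf_cong)
    fix n
    define x where "x = 1 - exp (- t) ^ Suc n"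
    have x: "x > 0" using t by (simp add: x_def power_Suc_less_one del: power_Suc)
    have "q_int (exp (- t)) (Suc n) = x / h"
      by (simp add: q_int_def x_def h_def)
    moreover have "complex_of_real (x / h) powr s = of_real x powr s / of_real h powr s"
      using x h by (simp add: powr_def Ln_of_real ln_div right_diff_distrib exp_diff flip: of_real_divide)
    moreover have "1 - v n = of_real x"
      by (simp add: v_def x_def)
    ultimately show "of_real (exp (- t)) powr (of_nat (Suc n) * (s - 1)) /
        of_real (q_int (exp (- t)) (Suc n)) powr s = of_real h powr s * (a n * (1 - v n) powr (- s))"
      unfolding powr a_def by (simp add: powr_minus divide_inverse)
  qed
  also have "\<dots> = of_real h powr s * (\<Sum>n. a n * (1 - v n) powr (- s))"
    using int unfolding M_def integrable_count_space_nat_iff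
    by (intro suminf_mult) (rule summable_norm_cancel)
  also have "(\<Sum>n. a n * (1 - v n) powr (- s)) = (\<Sum>r. binom_term t s r)"
    using integral_count_space_nat[OF int[unfolded M_def]] 1 by (simp add: M_def)
  finally show ?thesis
    by (simp add: q_zeta_binom_def h_def)
qed

text \<open>The continuation is unique among nicely meromorphic functions, and
  \<open>remove_sings\<close> turns the meromorphic \<open>q_zeta_binom\<close> into one without
  changing it on Re s > 1, where it is analytic.\<close>

lemma q_zeta_eq_remove_sings:
  assumes t: "t > 0"
  shows "q_zeta (exp (- t)) = remove_sings (q_zeta_binom t)"
  unfolding q_zeta_def
proof (rule meromorphic_continuation_eqI)
  show "remove_sings (q_zeta_binom t) nicely_meromorphic_on UNIV"
    by (rule remove_sings_nicely_meromorphic[OF meromorphic_q_zeta_binom[OF t]])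
  show "open {s. Re s > 1}" by (rule open_halfspace_Re_gt)
  have "2 \<in> {s. Re s > 1}" by simp
  then show "{s. Re s > 1} \<noteq> {}" by blast
  show "remove_sings (q_zeta_binom t) s = q_zeta_series (exp (- t)) s" if "s \<in> {s. Re s > 1}" for s
    using that analytic_q_zeta_binom[OF t] q_zeta_series_eq_binom[OF t] by simp
qed

subsection \<open>The integral representation\<close>

text \<open>At \<open>t = 0\<close> the quotients are junk (\<open>0 / 0 = 0\<close>), so the kernel is defined there by its limit.\<close>

definition bern_kernel :: "real \<Rightarrow> complex \<Rightarrow> complex \<Rightarrow> complex" where
  "bern_kernel t s z = (if t = 0 then z powr (1 - s) else
     of_real ((1 - exp (- t)) / t) * exp (- (of_real t * (s - 1)) * z) *
     ((1 - exp (- of_real t * z)) / of_real (1 - exp (- t))) powr (1 - s))"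

definition bern_int :: "real \<Rightarrow> complex \<Rightarrow> complex" where
  "bern_int t s = (\<integral>p. bern_kernel t s (bern_pt p) \<partial>bern_measure)"

text \<open>Division by a positive real leaves the argument unchanged, so no branch correction
  arises.\<close>

lemma powr_divide_of_real:
  fixes z b :: complex
  assumes "h > 0"
  shows "(z / of_real h) powr b = z powr b / of_real h powr b"
proof (cases "z = 0")
  case False
  then have "Ln (z / of_real h) = Ln z - of_real (ln h)"
    using assms by (simp add: Ln_divide_of_real)
  then show ?thesis
    using False assms by (simp add: powr_def Ln_of_real right_diff_distrib exp_diff)
qed simp

text \<open>The integral of a v^r supplies the numerator s - 1 + r, which turns the coefficients of
  (1 - v)^(1-s) into those of the q-zeta series: (s-1)_r (s - 1 + r) = (s - 1) (s)_r. The points 1,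
  0, -1, ... are excluded because there some w = t (s - 1 + r) is 0; they are reached later by a
  limit.\<close>

lemma q_zeta_binom_eq_bern_int:
  assumes t: "t > 0" and im: "t * \<bar>Im s\<bar> < 2 * pi" and s: "\<And>r. s - 1 + of_nat r \<noteq> 0"
  shows "(s - 1) * q_zeta_binom t s = bern_int t s"
proof -
  define h where "h = 1 - exp (- t)"
  have h: "h > 0" using t by (simp add: h_def)
  define a where "a = (\<lambda>p. exp (- (of_real t * (s - 1)) * bern_pt p))"
  define v where "v = (\<lambda>p. exp (- of_real t * bern_pt p))"
  define J where "J = (\<integral>p. a p * (1 - v p) powr (- (s - 1)) \<partial>bern_measure)"
  have s1: "s - 1 \<noteq> 0" using s[of 0] by simp
  have imr: "\<bar>Im (of_real t * (s - 1 + of_nat r))\<bar> < 2 * pi" for r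
    using im t by (simp add: abs_mult)
  have a: "integrable bern_measure a"
    unfolding a_def using has_bochner_integral_exp_bern_pt[OF imr[of 0]]
    by (simp add: has_bochner_integral_iff)
  have [measurable]: "v \<in> borel_measurable bern_measure"
    unfolding v_def by measurable
  have av: "a p * v p ^ r = exp (- (of_real t * (s - 1 + of_nat r)) * bern_pt p)" for p r
    by (simp add: a_def v_def algebra_simps flip: exp_of_nat_mult exp_add)
  have int: "(\<integral>p. a p * v p ^ r \<partial>bern_measure) =
      of_real t * (s - 1 + of_nat r) / (exp (of_real t * (s - 1 + of_nat r)) - 1)" for r
    unfolding av by (rule integral_exp_bern_pt[OF imr]) (use s t in auto)
  \<comment> \<open>On the line Re z = 1/2 the modulus of \<open>v\<close> is exactly exp(-t/2),
    which serves as \<rho>.\<close>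
  have "(\<lambda>r. pochhammer (s - 1) r / fact r * (\<integral>p. a p * v p ^ r \<partial>bern_measure)) sums J"
    unfolding J_def by (rule neg_binomial_integral[OF a _, where \<rho> = "exp (- t / 2)"]) (use t in \<open>auto simp: v_def\<close>)
  also have "(\<lambda>r. pochhammer (s - 1) r / fact r * (\<integral>p. a p * v p ^ r \<partial>bern_measure)) =
      (\<lambda>r. (s - 1) * of_real t * binom_term t s r)"
  proof
    fix r
    have "pochhammer (s - 1) r * (s - 1 + of_nat r) = (s - 1) * pochhammer s r"
      using pochhammer_rec[of "s - 1" r] pochhammer_Suc[of "s - 1" r] by simp
    moreover have "pochhammer (s - 1) r / fact r * (of_real t * (s - 1 + of_nat r) / X) =
        (pochhammer (s - 1) r * (s - 1 + of_nat r)) * of_real t / fact r / X" for X :: complex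
      by simp
    ultimately show "pochhammer (s - 1) r / fact r * (\<integral>p. a p * v p ^ r \<partial>bern_measure) =
        (s - 1) * of_real t * binom_term t s r"
      unfolding int binom_term_def by (simp only: times_divide_eq_right mult_ac)
  qed
  finally have "(\<lambda>r. binom_term t s r) sums (J / ((s - 1) * of_real t))"
    using s1 t sums_divide[of "\<lambda>r. (s - 1) * of_real t * binom_term t s r" J "(s - 1) * of_real t"] by simp
  then have "(s - 1) * q_zeta_binom t s = of_real h powr s / of_real t * J"
    using s1 by (simp add: q_zeta_binom_def sums_iff h_def)
  also have "\<dots> = (\<integral>p. of_real h powr s / of_real t * (a p * (1 - v p) powr (- (s - 1))) \<partial>bern_measure)"
    unfolding J_def by simp
  also have "\<dots> = bern_int t s"
    unfolding bern_int_def
  proof (intro Bochner_Integration.integral_cong refl)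
    fix p
    \<comment> \<open>The factor h^s / t equals (h / t) h^(s-1), and h^(s-1) is absorbed into the
      base of the power.\<close>
    have "((1 - v p) / of_real h) powr (1 - s) = (1 - v p) powr (1 - s) / of_real h powr (1 - s)"
      by (rule powr_divide_of_real[OF h])
    also have "of_real h powr (1 - s) = of_real h / of_real h powr s"
      using h by (simp add: powr_diff)
    finally have "((1 - v p) / of_real h) powr (1 - s) = (1 - v p) powr (1 - s) * of_real h powr s / of_real h"
      by simp
    moreover have "bern_kernel t s (bern_pt p) =
        of_real (h / t) * a p * ((1 - v p) / of_real h) powr (1 - s)"
      using t by (simp add: bern_kernel_def a_def v_def h_def)
    ultimately show "of_real h powr s / of_real t * (a p * (1 - v p) powr (- (s - 1))) = bern_kernel t s (bern_pt p)"
      using h by simp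
  qed
  finally show ?thesis .
qed

section \<open>Domination and limit of the kernel as t decreases to 0\<close>

text \<open>Apply ln u <= u - 1 to u = (1 + y) \<delta> / K; the scaling makes the slope \<delta>.
  It lets an exponential of small rate absorb a power of 1 + y.\<close>

lemma ln_one_plus_le_linear:
  fixes K \<delta> :: real
  assumes "K > 0" "\<delta> > 0"
  obtains C where "\<And>y. y \<ge> 0 \<Longrightarrow> K * ln (1 + y) \<le> \<delta> * y + C"
proof
  fix y :: real assume y: "y \<ge> 0"
  define \<epsilon> where "\<epsilon> = \<delta> / K"
  have \<epsilon>: "\<epsilon> > 0" using assms by (simp add: \<epsilon>_def)
  have "ln ((1 + y) * \<epsilon>) \<le> (1 + y) * \<epsilon> - 1"
    using y \<epsilon> by (intro ln_le_minus_one) simp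
  then have "ln (1 + y) \<le> (1 + y) * \<epsilon> - 1 - ln \<epsilon>"
    using y \<epsilon> by (simp add: ln_mult)
  then have "K * ln (1 + y) \<le> K * ((1 + y) * \<epsilon> - 1 - ln \<epsilon>)"
    using assms by (intro mult_left_mono) auto
  also have "\<dots> = \<delta> * y + (\<delta> - K * (1 + ln \<epsilon>))"
  proof -
    have "K * \<epsilon> = \<delta>" using assms by (simp add: \<epsilon>_def)
    moreover have "K * ((1 + y) * \<epsilon> - 1 - ln \<epsilon>) = K * \<epsilon> * y + (K * \<epsilon> - K * (1 + ln \<epsilon>))"
      by (simp add: algebra_simps)
    ultimately show ?thesis by (simp only:)
  qed
  finally show "K * ln (1 + y) \<le> \<delta> * y + (\<delta> - K * (1 + ln (\<delta> / K)))"
    by (simp add: \<epsilon>_def)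
qed

text \<open>The modulus of V^b is governed by Re b ln |V| - Im b arg V. As Re b may have either
  sign, |V| must be bounded from both sides; |arg V| is at most pi.\<close>

lemma norm_powr_le:
  fixes V b :: complex
  assumes B: "inverse B \<le> norm V" "norm V \<le> B" "B \<ge> 1" and b: "norm b \<le> K"
  shows "norm (V powr b) \<le> exp (K * (ln B + pi))"
proof -
  have V: "norm V > 0" using B by (meson less_le_trans positive_imp_inverse_positive zero_less_one)
  then have "V \<noteq> 0" by auto
  have "ln (norm V) \<le> ln B" using V B by simp
  moreover have "ln (inverse B) \<le> ln (norm V)" using V B by (subst ln_le_cancel_iff) auto
  then have "- ln B \<le> ln (norm V)" using B by (simp add: ln_inverse)
  ultimately have l: "\<bar>ln (norm V)\<bar> \<le> ln B" by simp
  have i: "\<bar>Im (Ln V)\<bar> \<le> pi"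
    using mpi_less_Im_Ln[OF \<open>V \<noteq> 0\<close>] Im_Ln_le_pi[OF \<open>V \<noteq> 0\<close>] by simp
  have K: "K \<ge> 0" using b norm_ge_zero order_trans by blast
  have "Re (b * Ln V) = Re b * ln (norm V) - Im b * Im (Ln V)"
    using \<open>V \<noteq> 0\<close> by simp
  also have "\<dots> \<le> \<bar>Re b * ln (norm V)\<bar> + \<bar>Im b * Im (Ln V)\<bar>" by linarith
  also have "\<dots> \<le> K * ln B + K * pi"
    unfolding abs_mult using b abs_Re_le_cmod[of b] abs_Im_le_cmod[of b] l i K
    by (intro add_mono mult_mono) auto
  finally have "Re (b * Ln V) \<le> K * (ln B + pi)" by (simp add: distrib_left)
  then show ?thesis
    using \<open>V \<noteq> 0\<close> by (simp add: powr_def)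
qed

lemma norm_one_minus_exp_le:
  fixes z :: complex
  assumes "Re z \<ge> 0"
  shows "norm (1 - exp (- z)) \<le> norm z"
proof -
  have "norm (exp (- z) - exp (- 0)) \<le> 1 * norm (z - 0)"
  proof (rule field_differentiable_bound[of "{w. Re w \<ge> 0}" "\<lambda>w. exp (- w)" "\<lambda>w. - exp (- w)"])
    show "convex {w. Re w \<ge> 0}" by (rule convex_halfspace_Re_ge)
    show "((\<lambda>w. exp (- w)) has_field_derivative - exp (- w)) (at w within {w. Re w \<ge> 0})" for w
      by (auto intro!: derivative_eq_intros)
  qed (use assms in auto)
  then show ?thesis by (simp add: norm_minus_commute)
qed

text \<open>The rate pi is spent in two halves. The exponential factor contributes |t Im s Im z| <=
  (pi/2) |Im z|. The base of the power lies between 1/2 and 3 (1 + |Im z|) uniformly in t, so the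
  power grows polynomially and fits into the other half.\<close>

lemma bern_kernel_bound:
  assumes R: "R > 0"
  obtains C where "\<And>t s z. 0 \<le> t \<Longrightarrow> t \<le> 1 \<Longrightarrow> t * R \<le> pi / 2 \<Longrightarrow> norm s \<le> R \<Longrightarrow> Re z = 1/2 \<Longrightarrow>
    norm (bern_kernel t s z) \<le> exp (C + pi * \<bar>Im z\<bar>)"
proof -
  define K where "K = R + 1"
  have K: "K > 0" using R by (simp add: K_def)
  obtain C0 where C0: "\<And>y. y \<ge> 0 \<Longrightarrow> K * ln (1 + y) \<le> pi / 2 * y + C0"
    using ln_one_plus_le_linear[OF K, of "pi / 2"] by auto
  have pw: "norm (V powr (1 - s)) \<le> exp (pi / 2 * \<bar>y\<bar> + (C0 + K * (ln 3 + pi)))"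
    if V: "norm V \<ge> 1/2" "norm V \<le> 3 * (1 + \<bar>y\<bar>)" and s: "norm s \<le> R" for V s :: complex and y :: real
  proof -
    have "norm (V powr (1 - s)) \<le> exp (K * (ln (3 * (1 + \<bar>y\<bar>)) + pi))"
    proof (rule norm_powr_le[OF _ V(2)])
      have "inverse (3 * (1 + \<bar>y\<bar>)) \<le> inverse 2" by (intro le_imp_inverse_le) auto
      then show "inverse (3 * (1 + \<bar>y\<bar>)) \<le> norm V" using V(1) by simp
      show "norm (1 - s) \<le> K"
        using norm_triangle_ineq4[of 1 s] s by (simp add: K_def)
    qed simp
    also have "K * (ln (3 * (1 + \<bar>y\<bar>)) + pi) = K * ln (1 + \<bar>y\<bar>) + K * (ln 3 + pi)"
      by (subst ln_mult) (auto simp: distrib_left)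
    also have "\<dots> \<le> pi / 2 * \<bar>y\<bar> + (C0 + K * (ln 3 + pi))"
      using C0[of "\<bar>y\<bar>"] by simp
    finally show ?thesis by simp
  qed
  define C where "C = C0 + K * (ln 3 + pi) + K / 2"
  show thesis
  proof (rule that[of C])
    fix t :: real and s z :: complex
    assume t: "0 \<le> t" "t \<le> 1" "t * R \<le> pi / 2" and s: "norm s \<le> R" and z: "Re z = 1/2"
    have z1: "norm z \<ge> 1/2" using abs_Re_le_cmod[of z] z by simp
    have z2: "norm z \<le> 1/2 + \<bar>Im z\<bar>" using cmod_le[of z] z by simp
    show "norm (bern_kernel t s z) \<le> exp (C + pi * \<bar>Im z\<bar>)"
    proof (cases "t = 0")
      case True
      have "norm (z powr (1 - s)) \<le> exp (pi / 2 * \<bar>Im z\<bar> + (C0 + K * (ln 3 + pi)))"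
        using z1 z2 s by (intro pw) auto
      also have "\<dots> \<le> exp (C + pi * \<bar>Im z\<bar>)"
        using K by (simp add: C_def)
      finally show ?thesis using True by (simp add: bern_kernel_def)
    next
      case False
      then have t0: "t > 0" using t by simp
      define h where "h = 1 - exp (- t)"
      have h: "0 < h" "h \<le> t" using t0 exp_ge_add_one_self[of "- t"] by (auto simp: h_def)
      \<comment> \<open>From exp t <= 3 and h = exp(-t) (exp t - 1) >= exp(-t) t follows h >= t/3,
        which keeps the base bounded by a multiple of |z|.\<close>
      have "exp (- t) * 3 \<ge> 1"
      proof -
        have "exp t \<le> exp (1 :: real)" using t by simp
        also have "\<dots> \<le> 3" by (rule exp_le)
        finally show ?thesis by (simp add: exp_minus field_simps)
      qed
      moreover have "h = exp (- t) * (exp t - 1)"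
        by (simp add: h_def right_diff_distrib flip: exp_add)
      moreover have "t * 1 \<le> (exp t - 1) * (exp (- t) * 3)"
      proof (rule mult_mono)
        show "t \<le> exp t - 1" using exp_ge_add_one_self[of t] by linarith
      qed (use calculation(1) t0 in auto)
      ultimately have h3: "t \<le> 3 * h" by (simp add: mult_ac)
      define V where "V = (1 - exp (- of_real t * z)) / of_real h"
      have nV: "norm V = norm (1 - exp (- of_real t * z)) / h"
        using h by (simp add: V_def norm_divide)
      have "norm (1 - exp (- of_real t * z)) \<le> t * norm z"
        using norm_one_minus_exp_le[of "of_real t * z"] t z by (simp add: norm_mult)
      also have "\<dots> \<le> 3 * h * (1 + \<bar>Im z\<bar>)"
        using h3 z2 t by (intro mult_mono) auto
      finally have V2: "norm V \<le> 3 * (1 + \<bar>Im z\<bar>)"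
        using h by (simp add: nV field_simps)
      \<comment> \<open>Since exp(-t/2) = |exp(-t z)|, this factorisation bounds h by 2 |1 - exp(-t
        z)|, so the base has modulus at least 1/2.\<close>
      have "h = (1 - exp (- t / 2)) * (1 + exp (- t / 2))"
        by (simp add: h_def algebra_simps flip: exp_add)
      also have "\<dots> \<le> (1 - exp (- t / 2)) * 2"
        using t0 by (intro mult_left_mono) auto
      also have "exp (- t / 2) = norm (exp (- of_real t * z))"
        using z by simp
      also have "(1 - norm (exp (- of_real t * z))) * 2 \<le> norm (1 - exp (- of_real t * z)) * 2"
        using norm_triangle_ineq2[of 1 "exp (- of_real t * z)"] by simp
      finally have V1: "norm V \<ge> 1/2"
        using h by (simp add: nV field_simps)
      have e: "norm (exp (- (of_real t * (s - 1)) * z)) \<le> exp (K / 2 + pi / 2 * \<bar>Im z\<bar>)"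
      proof -
        have "Re (- (of_real t * (s - 1)) * z) = t * ((1 - Re s) / 2) + t * (Im s * Im z)"
          by (simp add: z algebra_simps diff_divide_distrib)
        also have "t * ((1 - Re s) / 2) \<le> 1 * (K / 2)"
        proof -
          have "(1 - Re s) / 2 \<le> K / 2" using abs_Re_le_cmod[of s] s by (simp add: K_def)
          then have "t * ((1 - Re s) / 2) \<le> t * (K / 2)" using t by (intro mult_left_mono) auto
          also have "\<dots> \<le> 1 * (K / 2)" using t K by (intro mult_right_mono) auto
          finally show ?thesis .
        qed
        also have "t * (Im s * Im z) \<le> pi / 2 * \<bar>Im z\<bar>"
        proof -
          have "t * (Im s * Im z) \<le> t * (R * \<bar>Im z\<bar>)"
          proof (rule mult_left_mono)
            have "Im s * Im z \<le> \<bar>Im s\<bar> * \<bar>Im z\<bar>" by (metis abs_ge_self abs_mult)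
            also have "\<dots> \<le> R * \<bar>Im z\<bar>"
              using abs_Im_le_cmod[of s] s by (intro mult_right_mono) auto
            finally show "Im s * Im z \<le> R * \<bar>Im z\<bar>" .
          qed (rule t)
          also have "\<dots> = t * R * \<bar>Im z\<bar>" by simp
          also have "\<dots> \<le> pi / 2 * \<bar>Im z\<bar>" using t by (intro mult_right_mono) auto
          finally show ?thesis .
        qed
        finally show ?thesis by simp
      qed
      have "norm (bern_kernel t s z) =
          h / t * norm (exp (- (of_real t * (s - 1)) * z)) * norm (V powr (1 - s))"
        using False h t0 unfolding bern_kernel_def V_def h_def[symmetric] by (simp add: norm_mult norm_divide del: norm_exp_eq_Re)
      also have "\<dots> \<le> 1 * exp (K / 2 + pi / 2 * \<bar>Im z\<bar>) * exp (pi / 2 * \<bar>Im z\<bar> + (C0 + K * (ln 3 + pi)))"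
        using h t0 e pw[OF V1 V2 s] by (intro mult_mono) auto
      also have "\<dots> = exp (C + pi * \<bar>Im z\<bar>)"
        by (simp add: C_def algebra_simps flip: exp_add)
      finally show ?thesis .
    qed
  qed
qed

text \<open>The base is the ratio of the difference quotients (1 - exp(-t w)) / t at w = z and w =
  1, so it tends to z. The power is continuous there because Re z > 0 keeps z off the branch
  cut.\<close>

lemma tendsto_bern_kernel:
  assumes z: "Re z > 0"
  shows "((\<lambda>t. bern_kernel t s z) \<longlongrightarrow> bern_kernel 0 s z) (at_right 0)"
proof -
  have der: "((\<lambda>t. (1 - exp (- of_real t * w)) / of_real t) \<longlongrightarrow> w) (at_right (0::real))" for w :: complex
  proof -
    have "((\<lambda>u. 1 - exp (- u * w)) has_field_derivative w) (at 0)"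
      by (auto intro!: derivative_eq_intros)
    then have "((\<lambda>u. (1 - exp (- u * w)) / u) \<longlongrightarrow> w) (at 0)"
      by (simp add: has_field_derivative_iff)
    moreover have "filterlim (\<lambda>t::real. complex_of_real t) (at 0) (at_right 0)"
      by (rule filterlim_atI) (auto intro!: tendsto_eq_intros simp: eventually_at_filter)
    ultimately show ?thesis by (rule filterlim_compose)
  qed
  have d1: "((\<lambda>t. of_real ((1 - exp (- t)) / t)) \<longlongrightarrow> (1 :: complex)) (at_right 0)"
    using der[of 1] by (simp add: exp_of_real[symmetric])
  have V: "((\<lambda>t. (1 - exp (- of_real t * z)) / of_real (1 - exp (- t))) \<longlongrightarrow> z / 1) (at_right 0)"
  proof (rule Lim_transform_eventually[OF tendsto_divide[OF der[of z] d1]])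
    show "\<forall>\<^sub>F t in at_right (0::real). (1 - exp (- of_real t * z)) / of_real t / of_real ((1 - exp (- t)) / t) =
        (1 - exp (- of_real t * z)) / of_real (1 - exp (- t))"
      using eventually_at_right_less[of "0::real"] by eventually_elim simp
  qed simp
  have V: "((\<lambda>t. (1 - exp (- of_real t * z)) / of_real (1 - exp (- t))) \<longlongrightarrow> z) (at_right 0)"
    using V by (simp only: div_by_1)
  have "((\<lambda>t. of_real ((1 - exp (- t)) / t) * exp (- (of_real t * (s - 1)) * z) *
     ((1 - exp (- of_real t * z)) / of_real (1 - exp (- t))) powr (1 - s)) \<longlongrightarrow>
      1 * exp (- (of_real 0 * (s - 1)) * z) * z powr (1 - s)) (at_right 0)"
    by (intro tendsto_mult d1 tendsto_powr_complex tendsto_const tendsto_exp tendsto_minus tendsto_of_real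
        tendsto_ident_at V) (use z in \<open>auto simp: complex_nonpos_Reals_iff\<close>)
  then have "((\<lambda>t. of_real ((1 - exp (- t)) / t) * exp (- (of_real t * (s - 1)) * z) *
     ((1 - exp (- of_real t * z)) / of_real (1 - exp (- t))) powr (1 - s)) \<longlongrightarrow> bern_kernel 0 s z) (at_right 0)"
    by (simp add: bern_kernel_def)
  then show ?thesis
  proof (rule Lim_transform_eventually)
    show "\<forall>\<^sub>F t in at_right (0::real). of_real ((1 - exp (- t)) / t) * exp (- (of_real t * (s - 1)) * z) *
       ((1 - exp (- of_real t * z)) / of_real (1 - exp (- t))) powr (1 - s) = bern_kernel t s z"
      using eventually_at_right_less[of "0::real"] by eventually_elim (simp add: bern_kernel_def)
  qed
qed

lemma measurable_bern_kernel [measurable]: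
  "(\<lambda>p. bern_kernel t s (bern_pt p)) \<in> borel_measurable bern_measure"
  unfolding bern_kernel_def powr_def by measurable

lemma holomorphic_bern_kernel: "(\<lambda>s. bern_kernel t s z) holomorphic_on A"
proof -
  have "(\<lambda>s. b powr (1 - s)) holomorphic_on A" for b :: complex
    by (cases "b = 0") (auto simp: powr_def intro!: holomorphic_intros)
  then show ?thesis
    unfolding bern_kernel_def by (cases "t = 0") (auto intro!: holomorphic_intros)
qed

lemma integrable_bern_majorant: "integrable bern_measure (\<lambda>p. exp (C + pi * \<bar>Im (bern_pt p)\<bar>))"
  using integrable_exp_Im_bern_pt by (simp add: exp_add)

text \<open>For t = 0 the radius is unrestricted, so \<open>bern_int 0\<close> is entire; for t > 0
  the discs grow without bound as t decreases to 0.\<close>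

lemma holomorphic_bern_int:
  assumes "R > 0" "0 \<le> t" "t \<le> 1" "t * R \<le> pi / 2"
  shows "bern_int t holomorphic_on ball 0 R"
proof -
  obtain C where C: "\<And>t s z. 0 \<le> t \<Longrightarrow> t \<le> 1 \<Longrightarrow> t * R \<le> pi / 2 \<Longrightarrow> norm s \<le> R \<Longrightarrow> Re z = 1/2 \<Longrightarrow>
    norm (bern_kernel t s z) \<le> exp (C + pi * \<bar>Im z\<bar>)"
    using bern_kernel_bound[OF assms(1)] by blast
  show ?thesis
    unfolding bern_int_def
    by (rule holomorphic_on_lebesgue_integral[OF open_ball _ _ integrable_bern_majorant[of C]])
      (use assms C in \<open>auto intro: holomorphic_bern_kernel\<close>)
qed

lemma tendsto_bern_int: "((\<lambda>t. bern_int t s) \<longlongrightarrow> bern_int 0 s) (at_right 0)"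
proof -
  define R where "R = norm s + 1"
  have R: "R > 0" by (simp add: R_def add_nonneg_pos)
  \<comment> \<open>Below \<open>t0\<close> the uniform majorant for the disc of radius
    \<open>R\<close> applies.\<close>
  define t0 where "t0 = min 1 (pi / (2 * R))"
  have t0: "t0 > 0" using R by (simp add: t0_def)
  obtain C where C: "\<And>t s z. 0 \<le> t \<Longrightarrow> t \<le> 1 \<Longrightarrow> t * R \<le> pi / 2 \<Longrightarrow> norm s \<le> R \<Longrightarrow> Re z = 1/2 \<Longrightarrow>
    norm (bern_kernel t s z) \<le> exp (C + pi * \<bar>Im z\<bar>)"
    using bern_kernel_bound[OF R] by blast
  show ?thesis
  proof (rule tendsto_at_right_sequentially[OF t0])
    fix X :: "nat \<Rightarrow> real"
    assume X: "\<And>n. 0 < X n" "\<And>n. X n < t0" "X \<longlonglongrightarrow> 0"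
    have X1: "X n \<le> 1" "X n * R \<le> pi / 2" for n
      using X(2)[of n] R by (auto simp: t0_def field_simps)
    have "X n \<noteq> 0" for n using X(1)[of n] by simp
    then have lim: "filterlim X (at_right 0) sequentially"
      using X by (auto simp: filterlim_at)
    show "(\<lambda>n. bern_int (X n) s) \<longlonglongrightarrow> bern_int 0 s"
      unfolding bern_int_def
    proof (rule integral_dominated_convergence[OF _ _ integrable_bern_majorant[of C]])
      show "AE p in bern_measure. (\<lambda>n. bern_kernel (X n) s (bern_pt p)) \<longlonglongrightarrow> bern_kernel 0 s (bern_pt p)"
        by (auto intro!: AE_I2 filterlim_compose[OF tendsto_bern_kernel lim])
      show "AE p in bern_measure. norm (bern_kernel (X n) s (bern_pt p)) \<le> exp (C + pi * \<bar>Im (bern_pt p)\<bar>)" for n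
        using X(1)[of n] X1[of n] C by (auto intro!: AE_I2 simp: R_def)
    qed measurable
  qed
qed

subsection \<open>The limit\<close>

text \<open>Put x = t n. From h <= t and 1 - exp(-x) >= x / (1 + x) one gets [n]_q >= n / (1 + x).
  The loss (1 + x)^(Re s) is compensated by |q^(n(s-1))| = exp(-x (Re s - 1)), up to a constant
  independent of t and n.\<close>

lemma norm_q_zeta_term_le:
  assumes t: "t > 0" and s: "Re s > 1"
    and C: "\<And>y. y \<ge> 0 \<Longrightarrow> Re s * ln (1 + y) \<le> (Re s - 1) * y + C"
  shows "norm (of_real (exp (- t)) powr (of_nat (Suc n) * (s - 1)) /
      of_real (q_int (exp (- t)) (Suc n)) powr s) \<le> exp C * real (Suc n) powr (- Re s)"
proof -
  define x where "x = t * real (Suc n)"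
  have x: "x > 0" using t by (simp add: x_def)
  define h where "h = 1 - exp (- t)"
  have h: "0 < h" "h \<le> t" using t exp_ge_add_one_self[of "- t"] by (auto simp: h_def)
  have q: "q_int (exp (- t)) (Suc n) = (1 - exp (- x)) / h"
    by (simp add: q_int_def x_def h_def mult_ac flip: exp_of_nat_mult del: power_Suc of_nat_Suc)
  have "exp (- x) * (1 + x) \<le> exp (- x) * exp x"
    using exp_ge_add_one_self[of x] by (intro mult_left_mono) auto
  then have "x / (1 + x) \<le> 1 - exp (- x)"
    using x by (simp add: field_simps exp_minus)
  then have "x / (1 + x) / t \<le> (1 - exp (- x)) / h"
    using h x by (intro frac_le) auto
  then have q1: "real (Suc n) / (1 + x) \<le> q_int (exp (- t)) (Suc n)"
  proof -
    have "x / (1 + x) / t = real (Suc n) / (1 + x)" using t by (simp add: x_def)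
    with \<open>x / (1 + x) / t \<le> _\<close> show ?thesis by (simp only: q)
  qed
  have p: "real (Suc n) / (1 + x) > 0" using x by simp
  then have q0: "q_int (exp (- t)) (Suc n) > 0" using q1 by linarith
  have "norm (of_real (exp (- t)) powr (of_nat (Suc n) * (s - 1)) /
      of_real (q_int (exp (- t)) (Suc n)) powr s) =
      exp (- x * (Re s - 1)) / q_int (exp (- t)) (Suc n) powr Re s"
    using q0 by (simp add: norm_divide norm_powr_real_powr x_def powr_def[of "exp _"] algebra_simps)
  also have "\<dots> \<le> exp (- x * (Re s - 1)) / (real (Suc n) / (1 + x)) powr Re s"
    using p q0 q1 s by (intro divide_left_mono powr_mono2 mult_pos_pos) auto
  also have "\<dots> = exp (Re s * ln (1 + x) - (Re s - 1) * x) * real (Suc n) powr (- Re s)"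
    using x by (simp add: powr_divide powr_minus powr_def[of "1 + x"] field_simps exp_add exp_diff exp_minus del: of_nat_Suc)
  also have "\<dots> \<le> exp C * real (Suc n) powr (- Re s)"
    using C[of x] x by (intro mult_right_mono) auto
  finally show ?thesis .
qed

lemma tendsto_q_zeta_series:
  assumes s: "Re s > 1"
  shows "((\<lambda>t. q_zeta_series (exp (- t)) s) \<longlongrightarrow> (\<Sum>k. 1 / of_nat (Suc k) powr s)) (at_right 0)"
proof -
  obtain C where C: "\<And>y. y \<ge> 0 \<Longrightarrow> Re s * ln (1 + y) \<le> (Re s - 1) * y + C"
    using ln_one_plus_le_linear[of "Re s" "Re s - 1"] s by auto
  define a where "a = (\<lambda>k t. of_real (exp (- t)) powr (of_nat (Suc k) * (s - 1)) /
      of_real (q_int (exp (- t)) (Suc k)) powr s)"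
  have "((\<lambda>t. \<Sum>k. a k t) \<longlongrightarrow> (\<Sum>k. 1 / of_nat (Suc k) powr s)) (at_right 0)"
  proof (rule tannerys_theorem[THEN conjunct2, THEN conjunct2])
    fix k
    \<comment> \<open>The quotient defining \<open>q_int\<close> degenerates to 0 / 0 at q = 1, so
      the limit is taken in the geometric sum, whose value at q = 1 is \<open>Suc k\<close>.\<close>
    have q: "((\<lambda>t. q_int (exp (- t)) (Suc k)) \<longlongrightarrow> (\<Sum>i<Suc k. exp (- 0) ^ i)) (at_right 0)"
    proof (rule Lim_transform_eventually)
      show "((\<lambda>t. \<Sum>i<Suc k. exp (- t) ^ i) \<longlongrightarrow> (\<Sum>i<Suc k. exp (- 0 :: real) ^ i)) (at_right 0)"
        by (intro tendsto_intros)
      show "\<forall>\<^sub>F t in at_right 0. (\<Sum>i<Suc k. exp (- t) ^ i) = q_int (exp (- t)) (Suc k)"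
        using eventually_at_right_less[of "0::real"]
        by eventually_elim (simp add: q_int_def one_diff_power_eq del: power_Suc sum.lessThan_Suc)
    qed
    have "((\<lambda>t. of_real (q_int (exp (- t)) (Suc k))) \<longlongrightarrow> complex_of_real (\<Sum>i<Suc k. exp (- 0) ^ i)) (at_right 0)"
      by (intro tendsto_of_real q)
    then have q': "((\<lambda>t. of_real (q_int (exp (- t)) (Suc k))) \<longlongrightarrow> complex_of_nat (Suc k)) (at_right 0)"
      by (simp del: sum.lessThan_Suc)
    have e: "((\<lambda>t. complex_of_real (exp (- t))) \<longlongrightarrow> complex_of_real (exp (- 0))) (at_right 0)"
      by (intro tendsto_intros)
    have nz: "complex_of_nat (Suc k) \<notin> \<real>\<^sub>\<le>\<^sub>0"
      by (simp add: complex_nonpos_Reals_iff del: of_nat_Suc)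
    have "(a k \<longlongrightarrow> complex_of_real (exp (- 0)) powr (of_nat (Suc k) * (s - 1)) / of_nat (Suc k) powr s) (at_right 0)"
      unfolding a_def
      by (intro tendsto_divide tendsto_powr_complex e q' tendsto_const nz) (auto simp del: of_nat_Suc)
    then show "(a k \<longlongrightarrow> 1 / of_nat (Suc k) powr s) (at_right 0)"
      by simp
  next
    show "\<forall>\<^sub>F (k, t) in at_top \<times>\<^sub>F at_right 0. norm (a k t) \<le> exp C * real (Suc k) powr (- Re s)"
      unfolding eventually_prod_filter
    proof (intro exI conjI allI impI)
      show "\<forall>\<^sub>F k :: nat in at_top. True" by simp
      show "\<forall>\<^sub>F t in at_right (0::real). 0 < t" by (rule eventually_at_right_less)
      show "case (k, t) of (k, t) \<Rightarrow> norm (a k t) \<le> exp C * real (Suc k) powr (- Re s)" if "0 < t" for k t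
        unfolding prod.case a_def by (rule norm_q_zeta_term_le[OF that s C])
    qed
    have "summable (\<lambda>k. real (Suc k) powr (- Re s))"
      using s by (subst summable_Suc_iff) (simp add: summable_real_powr_iff)
    then show "summable (\<lambda>k. exp C * real (Suc k) powr (- Re s))"
      by (rule summable_mult)
  qed simp
  then show ?thesis
    by (simp add: q_zeta_series_def a_def Let_def)
qed

text \<open>For small t > 0, \<open>bern_int t s\<close> is (s - 1) times the q-zeta series.
  Tannery's theorem and dominated convergence compute its limit in two ways.\<close>

lemma bern_int_0_eq:
  assumes s: "Re s > 1"
  shows "bern_int 0 s = (s - 1) * (\<Sum>k. 1 / of_nat (Suc k) powr s)"
proof (rule tendsto_unique[OF _ tendsto_bern_int])
  have "\<forall>\<^sub>F t in at_right (0::real). t * \<bar>Im s\<bar> < 2 * pi"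
  proof (rule order_tendstoD(2))
    show "((\<lambda>t::real. t * \<bar>Im s\<bar>) \<longlongrightarrow> 0 * \<bar>Im s\<bar>) (at_right 0)" by (intro tendsto_intros)
  qed simp
  then have "\<forall>\<^sub>F t in at_right 0. (s - 1) * q_zeta_series (exp (- t)) s = bern_int t s"
    using eventually_at_right_less[of "0::real"]
  proof eventually_elim
    case (elim t)
    have "s - 1 + of_nat r \<noteq> 0" for r
    proof
      assume "s - 1 + of_nat r = 0"
      then have "Re (s - 1 + of_nat r) = 0" by simp
      then show False using s by simp
    qed
    then show ?case
      using elim s by (simp add: q_zeta_series_eq_binom q_zeta_binom_eq_bern_int)
  qed
  with tendsto_mult_left[OF tendsto_q_zeta_series[OF s], of "s - 1"]
  show "((\<lambda>t. bern_int t s) \<longlongrightarrow> (s - 1) * (\<Sum>k. 1 / of_nat (Suc k) powr s)) (at_right 0)"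
    by (rule Lim_transform_eventually)
qed simp

text \<open>The right-hand side is a witness for the choice defining \<open>zeta\<close>, so
  \<open>zeta\<close> has the specified properties; the identity theorem on the connected punctured
  plane makes the two agree.\<close>

lemma zeta_eq_bern_int:
  assumes "s \<noteq> 1"
  shows "zeta s = bern_int 0 s / (s - 1)"
proof -
  define P where "P = (\<lambda>g. g holomorphic_on - {1} \<and>
     (\<forall>s. Re s > 1 \<longrightarrow> g s = (\<Sum>k. 1 / of_nat (Suc k) powr s)))"
  define g where "g = (\<lambda>s. bern_int 0 s / (s - 1))"
  have "bern_int 0 holomorphic_on UNIV"
  proof (rule holomorphic_on_subset)
    show "bern_int 0 holomorphic_on (\<Union>R\<in>{0<..}. ball 0 R)"
      by (rule holomorphic_on_UN_open) (auto intro!: holomorphic_bern_int)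
    show "UNIV \<subseteq> (\<Union>R\<in>{0<..}. ball (0::complex) R)"
    proof
      fix z :: complex
      have "z \<in> ball 0 (norm z + 1)" "norm z + 1 \<in> {0<..}" by (auto intro: add_nonneg_pos)
      then show "z \<in> (\<Union>R\<in>{0<..}. ball 0 R)" by blast
    qed
  qed
  then have "g holomorphic_on - {1}"
    unfolding g_def by (intro holomorphic_intros) (auto intro: holomorphic_on_subset)
  moreover have "g s = (\<Sum>k. 1 / of_nat (Suc k) powr s)" if "Re s > 1" for s
    using bern_int_0_eq[OF that] that by (auto simp: g_def)
  ultimately have g: "P g" by (simp add: P_def)
  have "zeta = (SOME g. P g)" by (simp add: zeta_def P_def)
  with g have z: "P zeta" by (metis someI)
  have "zeta s - g s = 0"
  proof (rule analytic_continuation[of "\<lambda>s. zeta s - g s" "- {1}" "{s. Re s > 1}" 2])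
    show "(\<lambda>s. zeta s - g s) holomorphic_on - {1}"
      using g z by (auto simp: P_def intro!: holomorphic_intros)
    show "connected (- {1 :: complex})"
      by (intro connected_punctured_universe) simp
    show "2 islimpt {s. Re s > 1}"
      by (intro interior_limit_point) (simp add: interior_open open_halfspace_Re_gt)
  qed (use g z assms in \<open>auto simp: P_def\<close>)
  then show ?thesis by (simp add: g_def)
qed

text \<open>The integral formula is known only away from the exceptional integers. Letting z tend to
  \<open>s\<close> through non-integers identifies the value filled in by
  \<open>remove_sings\<close>, also at s = 0, -1, ...; the finiteness of this limit rules out a
  pole.\<close>

lemma q_zeta_eq_bern_int:
  assumes "s \<noteq> 1"
  shows "\<forall>\<^sub>F t in at_right 0. q_zeta (exp (- t)) s = bern_int t s / (s - 1) \<and>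
    \<not> is_pole (q_zeta (exp (- t))) s"
proof -
  define R where "R = norm s + 1"
  have R: "R > 0" by (simp add: R_def add_nonneg_pos)
  define t0 where "t0 = min 1 (pi / (2 * R))"
  have t0: "t0 > 0" using R by (simp add: t0_def)
  have main: "q_zeta (exp (- t)) s = bern_int t s / (s - 1) \<and> \<not> is_pole (q_zeta (exp (- t))) s"
    if t: "0 < t" "t < t0" for t
  proof -
    have tR: "t \<le> 1" "t * R \<le> pi / 2"
      using t R by (auto simp: t0_def field_simps)
    have hol: "(\<lambda>z. bern_int t z / (z - 1)) holomorphic_on ball 0 R - {1}"
      using holomorphic_bern_int[OF R _ tR] t
      by (intro holomorphic_intros) (auto intro: holomorphic_on_subset)
    have "isCont (\<lambda>z. bern_int t z / (z - 1)) s"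
      using holomorphic_on_imp_continuous_on[OF hol] assms
      by (subst (asm) continuous_on_eq_continuous_at) (auto simp: R_def open_Diff)
    then have lim: "(\<lambda>z. bern_int t z / (z - 1)) \<midarrow>s\<rightarrow> bern_int t s / (s - 1)"
      by (rule isContD)
    have "\<forall>\<^sub>F z in at s. z \<in> ball 0 R"
      by (rule eventually_at_in_open') (auto simp: R_def)
    moreover have "\<forall>\<^sub>F z in at s. z \<notin> \<int>"
    proof -
      \<comment> \<open>Any set of integers is closed, so a punctured neighbourhood of
        \<open>s\<close> contains no integer even if \<open>s\<close> is one.\<close>
      have "open (- (\<int> - {s}))"
        by (intro open_Compl closed_subset_Ints) auto
      then have "\<forall>\<^sub>F z in at s. z \<in> - (\<int> - {s}) - {s}"
        by (rule eventually_at_in_open) simp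
      then show ?thesis by eventually_elim auto
    qed
    ultimately have ev: "\<forall>\<^sub>F z in at s. bern_int t z / (z - 1) = q_zeta_binom t z"
    proof eventually_elim
      case (elim z)
      have nz: "z - 1 + of_nat r \<noteq> 0" for r
      proof
        assume "z - 1 + of_nat r = 0"
        then have "z = of_int (1 - int r)" by (simp add: algebra_simps)
        then show False using elim(2) by (metis Ints_of_int)
      qed
      have "t * \<bar>Im z\<bar> \<le> t * R"
        using elim(1) abs_Im_le_cmod[of z] t by (intro mult_left_mono) auto
      also have "\<dots> < 2 * pi" using tR(2) pi_gt_zero by linarith
      finally show ?case
        using q_zeta_binom_eq_bern_int[OF t(1) _ nz] nz[of 0] by (simp add: field_simps)
    qed
    have qb: "q_zeta_binom t \<midarrow>s\<rightarrow> bern_int t s / (s - 1)"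
      using lim ev by (rule Lim_transform_eventually)
    have "q_zeta (exp (- t)) s = bern_int t s / (s - 1)"
      unfolding q_zeta_eq_remove_sings[OF t(1)] using qb by (rule remove_sings_eqI)
    moreover have "q_zeta (exp (- t)) \<midarrow>s\<rightarrow> bern_int t s / (s - 1)"
      unfolding q_zeta_eq_remove_sings[OF t(1)] using qb
      by (subst tendsto_remove_sings_iff)
         (use meromorphic_q_zeta_binom[OF t(1)] in \<open>auto intro: meromorphic_on_isolated_singularity meromorphic_on_subset\<close>)
    ultimately show ?thesis
      unfolding is_pole_def using not_tendsto_and_filterlim_at_infinity[of "at s"] by auto
  qed
  show ?thesis
    unfolding eventually_at_right_field using t0 main by blast
qed

theorem theorem2:
  fixes s :: complex
  assumes "s \<noteq> 1"
  shows "(\<forall>\<^sub>F q in at_left (1::real). \<not> is_pole (q_zeta q) s) \<and>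
    ((\<lambda>q. q_zeta q s) \<longlongrightarrow> zeta s)
      (at (1::real) within {q. 0 < q \<and> q < 1 \<and> \<not> is_pole (q_zeta q) s})"
proof -
  have left: "\<forall>\<^sub>F q in at_left (1::real). 0 < q \<and> q < 1"
    using eventually_at_left_real[of 0 "1::real"] by simp
  \<comment> \<open>The substitution t = -ln q carries q increasing to 1 into t decreasing to
    0.\<close>
  have ln: "filterlim (\<lambda>q. - ln q) (at_right 0) (at_left (1::real))"
    unfolding filterlim_at
  proof
    show "\<forall>\<^sub>F q in at_left (1::real). - ln q \<in> {0<..} \<and> - ln q \<noteq> 0"
      using left by eventually_elim (auto simp: ln_less_zero)
    show "((\<lambda>q. - ln q) \<longlongrightarrow> 0) (at_left (1::real))"
      by (auto intro!: tendsto_eq_intros)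
  qed
  have ev: "\<forall>\<^sub>F q in at_left (1::real). q_zeta q s = bern_int (- ln q) s / (s - 1) \<and> \<not> is_pole (q_zeta q) s"
    using filterlim_iff[THEN iffD1, OF ln, rule_format, OF q_zeta_eq_bern_int[OF assms]] left
    by eventually_elim simp
  have "((\<lambda>q. bern_int (- ln q) s / (s - 1)) \<longlongrightarrow> zeta s) (at_left 1)"
    unfolding zeta_eq_bern_int[OF assms]
    by (intro tendsto_divide tendsto_const filterlim_compose[OF tendsto_bern_int ln]) (use assms in auto)
  then have "((\<lambda>q. q_zeta q s) \<longlongrightarrow> zeta s) (at_left 1)"
    by (rule Lim_transform_eventually) (use ev in \<open>auto elim: eventually_mono\<close>)
  then have "((\<lambda>q. q_zeta q s) \<longlongrightarrow> zeta s)
      (at (1::real) within {q. 0 < q \<and> q < 1 \<and> \<not> is_pole (q_zeta q) s})"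
    by (rule tendsto_within_subset) auto
  moreover have "\<forall>\<^sub>F q in at_left (1::real). \<not> is_pole (q_zeta q) s"
    using ev by eventually_elim simp
  ultimately show ?thesis by blast
qed

end
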